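(* Let $\mathbb{F}$ be an algebraically closed field with $\mathrm{Char}(\mathbb{F})\neq 2,3,5$, and let $i\in\mathbb{F}$ be a fixed element with $i^2=-1$. Then any nontrivial $2$-dimensional Jordan algebra over $\mathbb{F}$ is isomorphic to one and only one of the following algebras, given by their matrices of structure constants (different values of a parameter count as different algebras in the list): $$J_1=\begin{pmatrix}\frac12&0&0&1\\0&\frac12&\frac12&0\end{pmatrix},\qquad J_2=\begin{pmatrix}\frac12&0&0&1\\0&-\frac12&\frac12&0\end{pmatrix},$$ $$J_3(\alpha_1)=\begin{pmatrix}\alpha_1&0&0&0\\0&-1+2\alpha_1&-\alpha_1+1&0\end{pmatrix},\ \text{where }\alpha_1\in\mathbb{F},\ \alpha_1\neq\tfrac1{10}(5\pm\sqrt5),$$ $$J_4(\alpha_1)=\begin{pmatrix}\alpha_1&0&0&0\\0&\sqrt{\alpha_1-\alpha_1^2}&-\alpha_1+1&0\end{pmatrix},\ \text{where }\alpha_1\in\mathbb{F},$$ $$J_5(\alpha_1)=\begin{pmatrix}\alpha_1&0&0&0\\0&-\sqrt{\alpha_1-\alpha_1^2}&-\alpha_1+1&0\end{pmatrix},\ \text{where }\alpha_1\in\mathbb{F},\ \alpha_1\neq0,1,$$ $$J_6=\begin{pmatrix}\frac1{10}(5-\sqrt5)&0&0&0\\1&-\frac{\sqrt5}5&\frac1{10}(5+\sqrt5)&0\end{pmatrix},\qquad J_7=\begin{pmatrix}\frac1{10}(5+\sqrt5)&0&0&0\\1&\frac{\sqrt5}5&\frac1{10}(5-\sqrt5)&0\end{pmatrix},$$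 $$J_8=\begin{pmatrix}\frac13&0&0&0\\0&\frac23&-\frac13&0\end{pmatrix},\qquad J_9=\begin{pmatrix}\frac12-\frac i2&0&0&0\\0&\frac12+\frac i2&-\frac12+\frac i2&0\end{pmatrix},$$ $$J_{10}=\begin{pmatrix}\frac12+\frac i2&0&0&0\\0&\frac12-\frac i2&-\frac12-\frac i2&0\end{pmatrix},\qquad J_{11}=\begin{pmatrix}0&0&0&0\\1&0&0&0\end{pmatrix}.$$
   Context: An algebra over a field $\mathbb{F}$ is an $\mathbb{F}$-vector space $\mathbb{A}$ with a bilinear multiplication $\cdot$ (not assumed associative, commutative or unital); it is nontrivial if the multiplication is not identically zero. Two algebras are isomorphic if there is an invertible linear map between them preserving the multiplication. An algebra $\mathbb{A}$ is a Jordan algebra if $(\mathbf{u}\cdot\mathbf{v})\cdot\mathbf{u}^2=\mathbf{u}\cdot(\mathbf{v}\cdot\mathbf{u}^2)$ for all $\mathbf{u},\mathbf{v}\in\mathbb{A}$, where $\mathbf{u}^2=\mathbf{u}\cdot\mathbf{u}$; commutativity is NOT assumed. The matrix of structure constants $A=\begin{pmatrix}\alpha_1&\alpha_2&\alpha_3&\alpha_4\\\beta_1&\beta_2&\beta_3&\beta_4\end{pmatrix}$ of a $2$-dimensional algebra with respect to a basis $(e^1,e^2)$ is defined by $e^1\cdot e^1=\alpha_1e^1+\beta_1e^2$, $e^1\cdot e^2=\alpha_2e^1+\beta_2e^2$, $e^2\cdot e^1=\alpha_3e^1+\beta_3e^2$, $e^2\cdot e^2=\alpha_4e^1+\beta_4e^2$.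 An algebra is identified with its matrix of structure constants. For $a\in\mathbb{F}$, $\sqrt a$ denotes a fixed chosen square root of $a$ in $\mathbb{F}$. *)

theory Defs
  imports "HOL-Analysis.Analysis" "HOL-Computational_Algebra.Polynomial"
begin

locale nonassoc_algebra = vector_space smul
  for smul :: "'f::field \<Rightarrow> 'v::ab_group_add \<Rightarrow> 'v" +
  fixes prd :: "'v \<Rightarrow> 'v \<Rightarrow> 'v"
  assumes linear_mult_right: "Vector_Spaces.linear smul smul (\<lambda>v. prd u v)"
    and linear_mult_left: "Vector_Spaces.linear smul smul (\<lambda>u. prd u v)"

definition nontrivial_algebra :: "('v::ab_group_add \<Rightarrow> 'v \<Rightarrow> 'v) \<Rightarrow> bool" where
  "nontrivial_algebra prd \<longleftrightarrow> (\<exists>u v. prd u v \<noteq> 0)"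

text \<open>Commutativity is not part of the definition.\<close>

locale jordan_algebra = nonassoc_algebra +
  assumes jordan_identity: "prd (prd u v) (prd u u) = prd u (prd v (prd u u))"

definition algebra_isomorphic ::
  "('f::field \<Rightarrow> 'v::ab_group_add \<Rightarrow> 'v) \<Rightarrow> ('v \<Rightarrow> 'v \<Rightarrow> 'v) \<Rightarrow>
   ('f \<Rightarrow> 'w::ab_group_add \<Rightarrow> 'w) \<Rightarrow> ('w \<Rightarrow> 'w \<Rightarrow> 'w) \<Rightarrow> bool" where
  "algebra_isomorphic smul prd smul' prd' \<longleftrightarrow>
     (\<exists>f. Vector_Spaces.linear smul smul' f \<and> bij f \<and>
          (\<forall>u v. f (prd u v) = prd' (f u) (f v)))"

text \<open>
  Columns 1 to 4 of a matrix of structure constants hold the coordinates of the products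
  \<open>e1 e1\<close>, \<open>e1 e2\<close>, \<open>e2 e1\<close>, \<open>e2 e2\<close>, in this order.
\<close>

definition is_structure_matrix ::
  "('f::field \<Rightarrow> 'v::ab_group_add \<Rightarrow> 'v) \<Rightarrow> ('v \<Rightarrow> 'v \<Rightarrow> 'v) \<Rightarrow> 'v \<Rightarrow> 'v \<Rightarrow> 'f^4^2 \<Rightarrow> bool" where
  "is_structure_matrix smul prd e1 e2 A \<longleftrightarrow>
     prd e1 e1 = smul (A$1$1) e1 + smul (A$2$1) e2 \<and>
     prd e1 e2 = smul (A$1$2) e1 + smul (A$2$2) e2 \<and>
     prd e2 e1 = smul (A$1$3) e1 + smul (A$2$3) e2 \<and>
     prd e2 e2 = smul (A$1$4) e1 + smul (A$2$4) e2"

text \<open>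
  The algebra given by the matrix \<open>A\<close> is realised on \<open>'f^2\<close>, with \<open>A\<close> as its matrix of
  structure constants in the standard basis (see \<open>is_structure_matrix_mult\<close> below).
\<close>

definition structure_mult :: "'f::field^4^2 \<Rightarrow> 'f^2 \<Rightarrow> 'f^2 \<Rightarrow> 'f^2" where
  "structure_mult A x y =
     (\<chi> k. A$k$1 * (x$1 * y$1) + A$k$2 * (x$1 * y$2) + A$k$3 * (x$2 * y$1) + A$k$4 * (x$2 * y$2))"

lemma nonassoc_algebra_structure_mult: "nonassoc_algebra (*s) (structure_mult A)"
  by unfold_locales
    (simp_all only: structure_mult_def vec_eq_iff vec_lambda_beta vector_add_component
      vector_smult_component distrib_left distrib_right ac_simps simp_thms)

lemma is_structure_matrix_mult:
  "is_structure_matrix (*s) (structure_mult A) (axis 1 1) (axis 2 1) A"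
  by (simp add: is_structure_matrix_def structure_mult_def vec_eq_iff axis_def forall_2)

text \<open>
  The classification list is indexed by labels, so that different parameter values give
  different members of the list by construction.
\<close>

datatype 'f jordan_label =
  J1 | J2 | J3 'f | J4 'f | J5 'f | J6 | J7 | J8 | J9 | J10 | J11

text \<open>\<open>sqr a\<close> is the chosen square root of \<open>a\<close>.\<close>

fun admissible :: "('f::field \<Rightarrow> 'f) \<Rightarrow> 'f jordan_label \<Rightarrow> bool" where
  "admissible sqr (J3 a) \<longleftrightarrow> a \<noteq> 1/10 * (5 + sqr 5) \<and> a \<noteq> 1/10 * (5 - sqr 5)"
| "admissible sqr (J5 a) \<longleftrightarrow> a \<noteq> 0 \<and> a \<noteq> 1"
| "admissible sqr _ \<longleftrightarrow> True"

text \<open>\<open>im\<close> is the fixed square root of \<open>-1\<close>.\<close>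

fun jordan_matrix :: "('f::field \<Rightarrow> 'f) \<Rightarrow> 'f \<Rightarrow> 'f jordan_label \<Rightarrow> 'f^4^2" where
  "jordan_matrix sqr im J1 = vector
     [vector [1/2, 0, 0, 1],
      vector [0, 1/2, 1/2, 0]]"
| "jordan_matrix sqr im J2 = vector
     [vector [1/2, 0, 0, 1],
      vector [0, - 1/2, 1/2, 0]]"
| "jordan_matrix sqr im (J3 a) = vector
     [vector [a, 0, 0, 0],
      vector [0, - 1 + 2 * a, - a + 1, 0]]"
| "jordan_matrix sqr im (J4 a) = vector
     [vector [a, 0, 0, 0],
      vector [0, sqr (a - a^2), - a + 1, 0]]"
| "jordan_matrix sqr im (J5 a) = vector
     [vector [a, 0, 0, 0],
      vector [0, - sqr (a - a^2), - a + 1, 0]]"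
| "jordan_matrix sqr im J6 = vector
     [vector [1/10 * (5 - sqr 5), 0, 0, 0],
      vector [1, - (sqr 5 / 5), 1/10 * (5 + sqr 5), 0]]"
| "jordan_matrix sqr im J7 = vector
     [vector [1/10 * (5 + sqr 5), 0, 0, 0],
      vector [1, sqr 5 / 5, 1/10 * (5 - sqr 5), 0]]"
| "jordan_matrix sqr im J8 = vector
     [vector [1/3, 0, 0, 0],
      vector [0, 2/3, - 1/3, 0]]"
| "jordan_matrix sqr im J9 = vector
     [vector [1/2 - im/2, 0, 0, 0],
      vector [0, 1/2 + im/2, - 1/2 + im/2, 0]]"
| "jordan_matrix sqr im J10 = vector
     [vector [1/2 + im/2, 0, 0, 0],
      vector [0, 1/2 - im/2, - 1/2 - im/2, 0]]"
| "jordan_matrix sqr im J11 = vector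
     [vector [0, 0, 0, 0],
      vector [1, 0, 0, 0]]"

lemma vector_4:
  "(vector [a, b, c, d] :: 'a::zero^4)$1 = a"
  "(vector [a, b, c, d] :: 'a::zero^4)$2 = b"
  "(vector [a, b, c, d] :: 'a::zero^4)$3 = c"
  "(vector [a, b, c, d] :: 'a::zero^4)$4 = d"
  unfolding vector_def by simp_all

end

theory Submission
  imports Defs
begin

text \<open>
  An algebra is isomorphic to a member of the list exactly when it has a basis whose products are
  given by the matrix of that member (\<open>isomorphic_iff_table\<close>). Existence and uniqueness thus become
  questions about the bases of one fixed algebra.

  Existence. The condition \<open>u \<cdot> u \<in> \<langle>u\<rangle>\<close> on a vector \<open>u\<close> of a plane is the vanishing of a binary cubic
  form, so over an algebraically closed field a nonzero solution exists; after rescaling it is either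
  an idempotent or has square zero. Starting a basis with \<open>u\<close>, the Jordan identity is a
  family of cubic forms in the coordinates of its first argument, and the vanishing of
  their coefficients leaves few possibilities. If \<open>e1\<close> is idempotent, left and right multiplication by
  \<open>e1\<close> commute and can be diagonalised together: \<open>e1 e2 = b e2\<close>, \<open>e2 e1 = c e2\<close>. Either
  \<open>\<langle>e2\<rangle>\<close> can then be arranged to be an ideal with zero multiplication, or the algebra is unital and
  semisimple (\<open>J1\<close>), or \<open>b = - c\<close> and \<open>e2 e2\<close> is a nonzero multiple of \<open>e1\<close> (\<open>J2\<close>). If
  \<open>e1 e1 = 0\<close>, one finds an ideal line with zero multiplication or an idempotent.

  So apart from \<open>J1\<close> and \<open>J2\<close> there is a basis with \<open>e1 e1 = a e1 + s e2\<close>, \<open>e1 e2 = b e2\<close>,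
  \<open>e2 e1 = c e2\<close> and \<open>e2 e2 = 0\<close>. For such a table the Jordan identity implies
  \<open>(a - c - b) (b\<^sup>2 - a c) = 0\<close> and \<open>s (a c - b\<^sup>2) = 0\<close>. Scaling \<open>e1\<close> multiplies \<open>(a, b, c)\<close> by a
  scalar, which allows \<open>a + c = 1\<close> unless \<open>a + c = 0\<close>. With \<open>a + c = 1\<close> the two factors give the
  families \<open>J3\<close>, \<open>J4\<close> and \<open>J5\<close>; with \<open>a + c = 0\<close> they give \<open>J8\<close>, \<open>J9\<close> and \<open>J10\<close>. The entry \<open>s\<close> can
  be removed by a shear unless \<open>a = b + c\<close>, and what remains in that case is \<open>J6\<close>, \<open>J7\<close> and \<open>J11\<close>.

  Uniqueness. In a nontrivial plane algebra at most one line is an ideal with zero multiplication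
  (\<open>square_zero_ideal_unique\<close>). When there is one, \<open>(a, b, c)\<close> is an invariant up to a common factor,
  and if \<open>a = b + c\<close> then so is the vanishing of \<open>s\<close>; these invariants separate
  \<open>J3\<close> to \<open>J11\<close>. The algebras \<open>J1\<close> and \<open>J2\<close> have no such line, and only the first is commutative.
\<close>

section \<open>Bases and multiplication tables of plane algebras\<close>

context nonassoc_algebra
begin

definition comb :: "'v \<Rightarrow> 'v \<Rightarrow> 'f \<Rightarrow> 'f \<Rightarrow> 'v" where
  "comb e1 e2 x y = smul x e1 + smul y e2"

definition basis2 :: "'v \<Rightarrow> 'v \<Rightarrow> bool" where
  "basis2 e1 e2 \<longleftrightarrow>
     (\<forall>x y. comb e1 e2 x y = 0 \<longrightarrow> x = 0 \<and> y = 0) \<and> (\<forall>v. \<exists>x y. v = comb e1 e2 x y)"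

text \<open>
  The entries are listed as the rows of the matrix of structure constants: those with index \<open>i\<close>
  are the two coordinates of the \<open>i\<close>th of the products \<open>e1 e1\<close>, \<open>e1 e2\<close>, \<open>e2 e1\<close>, \<open>e2 e2\<close>.
\<close>

definition table :: "'v \<Rightarrow> 'v \<Rightarrow> 'f \<Rightarrow> 'f \<Rightarrow> 'f \<Rightarrow> 'f \<Rightarrow> 'f \<Rightarrow> 'f \<Rightarrow> 'f \<Rightarrow> 'f \<Rightarrow> bool" where
  "table e1 e2 a1 a2 a3 a4 b1 b2 b3 b4 \<longleftrightarrow> basis2 e1 e2 \<and>
     is_structure_matrix smul prd e1 e2 (vector [vector [a1, a2, a3, a4], vector [b1, b2, b3, b4]])"

lemma comb_eq_iff:
  assumes "basis2 e1 e2"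
  shows "comb e1 e2 x y = comb e1 e2 x' y' \<longleftrightarrow> x = x' \<and> y = y'"
proof
  assume "comb e1 e2 x y = comb e1 e2 x' y'"
  then have "comb e1 e2 (x - x') (y - y') = 0"
    by (simp add: comb_def scale_left_diff_distrib) (simp add: algebra_simps)
  then show "x = x' \<and> y = y'"
    using assms unfolding basis2_def by (metis eq_iff_diff_eq_0)
qed auto

lemma comb_eq_0_iff:
  assumes "basis2 e1 e2"
  shows "comb e1 e2 x y = 0 \<longleftrightarrow> x = 0 \<and> y = 0"
  using comb_eq_iff[OF assms, of x y 0 0] by (simp add: comb_def)

lemma basis2_coords:
  assumes "basis2 e1 e2"
  obtains x y where "v = comb e1 e2 x y"
  using assms unfolding basis2_def by blast

lemma comb_comb:
  "comb (comb e1 e2 p q) (comb e1 e2 r w) x y = comb e1 e2 (x * p + y * r) (x * q + y * w)"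
  by (simp add: comb_def scale_left_distrib scale_right_distrib algebra_simps)

lemma smul_comb: "smul k (comb e1 e2 x y) = comb e1 e2 (k * x) (k * y)"
  by (simp add: comb_def scale_right_distrib)

lemma comb_zero: "comb e1 e2 0 0 = 0"
  by (simp add: comb_def)

lemma comb_simps: "comb e1 e2 1 0 = e1" "comb e1 e2 0 1 = e2"
  by (simp_all add: comb_def)

lemma prd_bilinear:
  "prd (u + u') v = prd u v + prd u' v" "prd u (v + v') = prd u v + prd u v'"
  "prd (smul k u) v = smul k (prd u v)" "prd u (smul k v) = smul k (prd u v)"
  using linear_mult_right[of u] linear_mult_left[of v]
  by (simp_all add: Vector_Spaces.linear_iff)

lemma table_iff:
  "table e1 e2 a1 a2 a3 a4 b1 b2 b3 b4 \<longleftrightarrow> basis2 e1 e2 \<and>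
     prd e1 e1 = comb e1 e2 a1 b1 \<and> prd e1 e2 = comb e1 e2 a2 b2 \<and>
     prd e2 e1 = comb e1 e2 a3 b3 \<and> prd e2 e2 = comb e1 e2 a4 b4"
  by (simp add: table_def is_structure_matrix_def comb_def vector_4 vector_2)

lemma prd_comb:
  assumes "table e1 e2 a1 a2 a3 a4 b1 b2 b3 b4"
  shows "prd (comb e1 e2 x y) (comb e1 e2 z w) =
    comb e1 e2 (a1*x*z + a2*x*w + a3*y*z + a4*y*w) (b1*x*z + b2*x*w + b3*y*z + b4*y*w)"
proof -
  have "prd (comb e1 e2 x y) (comb e1 e2 z w) =
     smul (x*z) (prd e1 e1) + smul (x*w) (prd e1 e2) + smul (y*z) (prd e2 e1) + smul (y*w) (prd e2 e2)"
    by (simp add: comb_def prd_bilinear scale_right_distrib algebra_simps)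
  then show ?thesis
    using assms
    by (simp add: table_iff comb_def scale_left_distrib scale_right_distrib algebra_simps)
qed

lemma basis2_change:
  assumes b: "basis2 e1 e2" and d: "p * w - q * r \<noteq> 0"
  shows "basis2 (comb e1 e2 p q) (comb e1 e2 r w)"
  unfolding basis2_def
proof (intro conjI allI impI)
  fix x y
  assume "comb (comb e1 e2 p q) (comb e1 e2 r w) x y = 0"
  then have "x * p + y * r = 0 \<and> x * q + y * w = 0"
    using b unfolding comb_comb basis2_def by blast
  moreover have "x * (p * w - q * r) = (x * p + y * r) * w - (x * q + y * w) * r"
    "y * (p * w - q * r) = (x * q + y * w) * p - (x * p + y * r) * q"
    by (simp_all add: algebra_simps)
  ultimately have "x * (p * w - q * r) = 0" "y * (p * w - q * r) = 0"
    by simp_all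
  then show "x = 0" "y = 0"
    using d by simp_all
next
  fix v
  obtain x y where v: "v = comb e1 e2 x y"
    using b unfolding basis2_def by blast
  let ?d = "p * w - q * r"
  let ?X = "(x * w - y * r) / ?d" and ?Y = "(y * p - x * q) / ?d"
  have "?X * p + ?Y * r = x * ?d / ?d"
    unfolding times_divide_eq_left add_divide_distrib[symmetric]
    by (rule arg_cong2[where f = "(/)"]) (simp_all add: algebra_simps)
  moreover have "?X * q + ?Y * w = y * ?d / ?d"
    unfolding times_divide_eq_left add_divide_distrib[symmetric]
    by (rule arg_cong2[where f = "(/)"]) (simp_all add: algebra_simps)
  ultimately have "v = comb (comb e1 e2 p q) (comb e1 e2 r w) ?X ?Y"
    using d by (simp only: v comb_comb nonzero_mult_div_cancel_right[OF d])
  then show "\<exists>x y. v = comb (comb e1 e2 p q) (comb e1 e2 r w) x y"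
    by blast
qed

text \<open>
  The hypotheses compare the old coordinates of each product of new basis vectors with those
  prescribed by the new table, so a change of basis reduces to ring identities.
\<close>

lemma table_change:
  assumes t: "table e1 e2 a1 a2 a3 a4 b1 b2 b3 b4" and d: "p * w - q * r \<noteq> 0"
    and "a1*p*p + a2*p*q + a3*q*p + a4*q*q = a1'*p + b1'*r"
    and "b1*p*p + b2*p*q + b3*q*p + b4*q*q = a1'*q + b1'*w"
    and "a1*p*r + a2*p*w + a3*q*r + a4*q*w = a2'*p + b2'*r"
    and "b1*p*r + b2*p*w + b3*q*r + b4*q*w = a2'*q + b2'*w"
    and "a1*r*p + a2*r*q + a3*w*p + a4*w*q = a3'*p + b3'*r"
    and "b1*r*p + b2*r*q + b3*w*p + b4*w*q = a3'*q + b3'*w"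
    and "a1*r*r + a2*r*w + a3*w*r + a4*w*w = a4'*p + b4'*r"
    and "b1*r*r + b2*r*w + b3*w*r + b4*w*w = a4'*q + b4'*w"
  shows "table (comb e1 e2 p q) (comb e1 e2 r w) a1' a2' a3' a4' b1' b2' b3' b4'"
proof -
  have "basis2 (comb e1 e2 p q) (comb e1 e2 r w)"
    using basis2_change t d by (simp add: table_def)
  then show ?thesis
    unfolding table_iff comb_comb prd_comb[OF t] using assms(3-) by simp
qed

lemma basis_table:
  assumes b: "basis2 e1 e2"
  obtains a1 a2 a3 a4 b1 b2 b3 b4 where "table e1 e2 a1 a2 a3 a4 b1 b2 b3 b4"
proof -
  have "\<exists>x y. v = comb e1 e2 x y" for v
    using b unfolding basis2_def by blast
  then show thesis
    using that b unfolding table_iff by metis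
qed

text \<open>
  An isomorphism onto the coordinate algebra pulls the standard basis back to a basis with the same
  structure constants; conversely, the coordinate map of a basis is an isomorphism.
\<close>

lemma isomorphic_iff_table:
  "algebra_isomorphic smul prd (*s)
      (structure_mult (vector [vector [a1, a2, a3, a4], vector [b1, b2, b3, b4]] :: 'f^4^2)) \<longleftrightarrow>
   (\<exists>e1 e2. table e1 e2 a1 a2 a3 a4 b1 b2 b3 b4)"
  (is "algebra_isomorphic _ _ _ (structure_mult ?A) \<longleftrightarrow> _")
proof
  assume "algebra_isomorphic smul prd (*s) (structure_mult ?A)"
  then obtain f :: "'v \<Rightarrow> 'f^2" where lin: "Vector_Spaces.linear smul (*s) f" and bij: "bij f"
    and hom: "\<And>u v. f (prd u v) = structure_mult ?A (f u) (f v)"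
    unfolding algebra_isomorphic_def by blast
  interpret f: Vector_Spaces.linear smul "(*s)" f by fact
  define e1 e2 where "e1 = inv f (axis 1 1)" and "e2 = inv f (axis 2 1)"
  have fe: "f e1 = axis 1 1" "f e2 = axis 2 1"
    using bij by (simp_all add: e1_def e2_def bij_is_surj surj_f_inv_f)
  have fc: "f (comb e1 e2 x y) = x *s axis 1 1 + y *s axis 2 1" for x y
    by (simp add: comb_def f.add f.scale fe)
  have inj: "f u = f v \<Longrightarrow> u = v" for u v
    using bij by (simp add: bij_def inj_eq)
  have b: "basis2 e1 e2"
    unfolding basis2_def
  proof (intro conjI allI impI)
    fix x y
    assume "comb e1 e2 x y = 0"
    then have "f (comb e1 e2 x y) = 0"
      by (simp add: f.zero)
    then show "x = 0" "y = 0"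
      by (simp_all add: fc vec_eq_iff axis_def forall_2)
  next
    fix v
    have "f v = f (comb e1 e2 (f v $ 1) (f v $ 2))"
      by (simp add: fc vec_eq_iff axis_def forall_2)
    then show "\<exists>x y. v = comb e1 e2 x y"
      using inj by blast
  qed
  have "table e1 e2 a1 a2 a3 a4 b1 b2 b3 b4"
    unfolding table_iff
    by (intro conjI b; rule inj)
      (simp_all add: hom fc fe structure_mult_def vec_eq_iff axis_def forall_2 vector_4 vector_2)
  then show "\<exists>e1 e2. table e1 e2 a1 a2 a3 a4 b1 b2 b3 b4"
    by blast
next
  assume "\<exists>e1 e2. table e1 e2 a1 a2 a3 a4 b1 b2 b3 b4"
  then obtain e1 e2 where t: "table e1 e2 a1 a2 a3 a4 b1 b2 b3 b4"
    by blast
  then have b: "basis2 e1 e2"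
    by (simp add: table_def)
  define g :: "'f^2 \<Rightarrow> 'v" where "g z = comb e1 e2 (z $ 1) (z $ 2)" for z
  have "bij g"
  proof (rule bijI)
    show "inj g"
      by (rule injI) (simp add: g_def comb_eq_iff[OF b] vec_eq_iff forall_2)
    show "surj g"
    proof (rule surjI)
      fix v
      have "\<exists>x y. v = comb e1 e2 x y"
        using b unfolding basis2_def by blast
      then have "\<exists>z. g z = v"
        by (metis g_def vector_2)
      then show "g (SOME z. g z = v) = v"
        by (rule someI_ex)
    qed
  qed
  have add: "g (z + z') = g z + g z'" and scale: "g (k *s z) = smul k (g z)" for z z' k
    by (simp_all add: g_def comb_def scale_left_distrib scale_right_distrib)
  have hom: "g (structure_mult ?A z z') = prd (g z) (g z')" for z z'
    by (simp add: g_def prd_comb[OF t] structure_mult_def vector_4 vector_2 mult.assoc)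
  have gi: "g (inv g v) = v" "inv g (g z) = z" for v z
    using \<open>bij g\<close> by (simp_all add: bij_is_surj surj_f_inv_f bij_is_inj)
  have "Vector_Spaces.linear smul (*s) (inv g)"
    unfolding Vector_Spaces.linear_iff
  proof (intro conjI allI)
    show "vector_space smul" ..
    show "vector_space ((*s) :: 'f \<Rightarrow> 'f^2 \<Rightarrow> 'f^2)" ..
    show "inv g (u + v) = inv g u + inv g v" for u v
      by (metis gi add)
    show "inv g (smul k v) = k *s inv g v" for k v
      by (metis gi scale)
  qed
  moreover have "bij (inv g)"
    using \<open>bij g\<close> by (rule bij_imp_bij_inv)
  moreover have "inv g (prd u v) = structure_mult ?A (inv g u) (inv g v)" for u v
    by (metis gi hom)
  ultimately show "algebra_isomorphic smul prd (*s) (structure_mult ?A)"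
    unfolding algebra_isomorphic_def by blast
qed

lemma dim2_basis2:
  assumes "dim UNIV = 2"
  obtains e1 e2 where "basis2 e1 e2"
proof -
  obtain B where B: "independent B" "UNIV \<subseteq> span B" "card B = 2"
    using basis_exists[of UNIV] assms by metis
  obtain e1 e2 where e: "B = {e1, e2}" "e1 \<noteq> e2"
    using B(3) by (auto simp: card_2_iff)
  have "\<exists>x y. v = comb e1 e2 x y" for v
  proof -
    have "v \<in> span {e1, e2}"
      using B(2) e by blast
    then obtain x y where "v - smul x e1 = smul y e2"
      by (auto simp: span_insert span_singleton)
    then have "v = comb e1 e2 x y"
      by (simp add: comb_def algebra_simps)
    then show ?thesis by blast
  qed
  moreover have "x = 0 \<and> y = 0" if "comb e1 e2 x y = 0" for x y
  proof -
    define c where "c v = (if v = e1 then x else y)" for v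
    have "(\<Sum>v\<in>{e1, e2}. smul (c v) v) = 0"
      using that e by (simp add: c_def comb_def)
    then have "\<forall>v\<in>{e1, e2}. c v = 0"
      using B(1) independentD[of B "{e1, e2}" c] e by auto
    then show ?thesis
      using e by (simp add: c_def split: if_splits)
  qed
  ultimately show thesis
    using that unfolding basis2_def by blast
qed

lemma table_scale:
  assumes "table e1 e2 a1 a2 a3 a4 b1 b2 b3 b4" "t \<noteq> 0" "w \<noteq> 0"
  shows "table (comb e1 e2 t 0) (comb e1 e2 0 w)
    (t * a1) (w * a2) (w * a3) (w\<^sup>2 / t * a4) (t\<^sup>2 / w * b1) (t * b2) (t * b3) (w * b4)"
  using assms(2,3) by (intro table_change[OF assms(1)]) (simp_all add: power2_eq_square)

lemma eigen_square_table:
  assumes "basis2 u v" "prd u u = smul k u"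
  obtains l r p b c q where "table u v k l r p 0 b c q"
proof -
  obtain a1 l r p b1 b c q where t: "table u v a1 l r p b1 b c q"
    by (rule basis_table[OF assms(1)])
  then have "comb u v a1 b1 = comb u v k 0"
    using assms(2) unfolding table_iff by (simp add: comb_def)
  then show thesis
    using t that[of l r p b c q] comb_eq_iff[OF assms(1), of a1 b1 k 0] by simp
qed

lemma nontrivial_table:
  assumes "table e1 e2 0 0 0 0 0 0 0 0"
  shows "\<not> nontrivial_algebra prd"
proof -
  have "prd u v = 0" for u v
  proof -
    have "basis2 e1 e2"
      using assms by (simp add: table_def)
    then obtain x y z w where "u = comb e1 e2 x y" "v = comb e1 e2 z w"
      by (meson basis2_coords)
    then show ?thesis
      using prd_comb[OF assms, of x y z w] by (simp add: comb_zero)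
  qed
  then show ?thesis
    by (simp add: nontrivial_algebra_def)
qed

section \<open>Ideal lines with zero multiplication\<close>

text \<open>
  In both tables the second basis vector spans an ideal with zero multiplication. If these lines were
  different, \<open>e2\<close> and \<open>f2\<close> would form a basis, and \<open>e2 f2\<close> and \<open>f2 e2\<close> would lie in both lines and
  vanish, so the multiplication would be zero. Hence \<open>f1 = p e1 + q e2\<close> and
  \<open>f2 = w e2\<close>, which fixes how the entries of the tables are related; \<open>q\<close> contributes
  \<open>p q (b + c - a)\<close> to the coordinate \<open>w s'\<close> of \<open>f1 f1\<close>, which is why \<open>s\<close> matters only
  if \<open>a = b + c\<close>.
\<close>

lemma square_zero_ideal_unique:
  assumes e: "table e1 e2 a 0 0 0 s b c 0" and f: "table f1 f2 a' 0 0 0 s' b' c' 0"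
    and nontrivial: "nontrivial_algebra prd"
  shows "\<exists>p. p \<noteq> 0 \<and> a' = p * a \<and> b' = p * b \<and> c' = p * c \<and> (a = b + c \<longrightarrow> (s = 0 \<longleftrightarrow> s' = 0))"
proof -
  have be: "basis2 e1 e2" and bf: "basis2 f1 f2"
    using e f by (simp_all add: table_def)
  note eq = comb_eq_iff[OF be] comb_eq_0_iff[OF be]
  obtain p q r w x y where f1: "f1 = comb e1 e2 p q" and f2: "f2 = comb e1 e2 r w"
    and e2: "e2 = comb f1 f2 x y"
    by (meson basis2_coords be bf)
  have ff: "prd f2 f2 = 0" "prd f1 f2 = smul b' f2" "prd f2 f1 = smul c' f2"
    "prd f1 f1 = comb f1 f2 a' s'"
    using f by (simp_all add: table_iff comb_def)
  \<comment> \<open>\<open>r \<noteq> 0\<close> would make the two lines different.\<close>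
  have "r = 0"
  proof (rule ccontr)
    assume r: "r \<noteq> 0"
    have "prd e2 f2 = comb e1 e2 0 (c * r)"
      using prd_comb[OF e, of 0 1 r w] by (simp add: comb_simps f2)
    moreover have "prd e2 f2 = smul (x * b') f2"
      by (simp add: e2 comb_def prd_bilinear ff)
    ultimately have "c = 0"
      using r by (auto simp: f2 smul_comb eq)
    have "prd f2 e2 = comb e1 e2 0 (b * r)"
      using prd_comb[OF e, of r w 0 1] by (simp add: comb_simps f2)
    moreover have "prd f2 e2 = smul (x * c') f2"
      by (simp add: e2 comb_def prd_bilinear ff)
    ultimately have "b = 0"
      using r by (auto simp: f2 smul_comb eq)
    have "a = 0" "s = 0"
      using ff(1) r \<open>b = 0\<close> \<open>c = 0\<close> by (simp_all add: f2 prd_comb[OF e] eq)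
    then show False
      using nontrivial_table e nontrivial \<open>b = 0\<close> \<open>c = 0\<close> by blast
  qed
  have w: "w \<noteq> 0"
  proof
    assume "w = 0"
    then have "comb f1 f2 0 1 = 0"
      by (simp add: f2 \<open>r = 0\<close> comb_zero comb_simps)
    then show False
      by (simp add: comb_eq_0_iff[OF bf])
  qed
  have p: "p \<noteq> 0"
  proof
    assume "p = 0"
    then have "comb f1 f2 w (- q) = 0"
      by (simp add: f1 f2 \<open>r = 0\<close> comb_comb comb_zero)
    then show False
      using w by (simp add: comb_eq_0_iff[OF bf])
  qed
  have b': "b' = p * b" and c': "c' = p * c"
    using ff(2,3) w by (auto simp: f1 f2 \<open>r = 0\<close> prd_comb[OF e] smul_comb eq)
  have "a * p * p = a' * p" and s: "s * p * p + b * p * q + c * q * p = a' * q + s' * w"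
    using ff(4) by (simp_all add: f1 f2 \<open>r = 0\<close> prd_comb[OF e] comb_comb eq)
  then have a': "a' = p * a"
    using p by (simp add: mult.commute)
  have "s = 0 \<longleftrightarrow> s' = 0" if "a = b + c"
  proof -
    have "s * (p * p) = s' * w"
      using s a' that by (simp add: algebra_simps)
    then show ?thesis
      using p w by (metis mult_eq_0_iff)
  qed
  then show ?thesis
    using p a' b' c' by blast
qed

text \<open>
  The first table is that of \<open>J1\<close> or \<open>J2\<close>. For \<open>f2 = r e1 + w e2\<close>, the two coordinates of \<open>f2 f2 = 0\<close>
  and the condition that \<open>e1 f2\<close> is a multiple of \<open>f2\<close> give \<open>r w = 0\<close> and \<open>r\<^sup>2 / 2 + w\<^sup>2 = 0\<close>, which
  leave only \<open>f2 = 0\<close>.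
\<close>

lemma no_square_zero_ideal:
  assumes two: "(2::'f) \<noteq> 0"
    and e: "table e1 e2 (1/2) 0 0 1 0 b (1/2) 0" and b: "b = 1/2 \<or> b = - (1/2)"
    and f: "table f1 f2 a' 0 0 0 s' b' c' 0"
  shows False
proof -
  have be: "basis2 e1 e2" and bf: "basis2 f1 f2"
    using e f by (simp_all add: table_def)
  note eq = comb_eq_iff[OF be] comb_eq_0_iff[OF be]
  obtain r w x y where f2: "f2 = comb e1 e2 r w" and e1: "e1 = comb f1 f2 x y"
    by (meson basis2_coords be bf)
  have ff: "prd f2 f2 = 0" "prd f1 f2 = smul b' f2"
    using f by (simp_all add: table_iff comb_def)
  have sq: "r * r / 2 + w * w = 0" "(b + 1/2) * (r * w) = 0"
    using ff(1) by (simp_all add: f2 prd_comb[OF e] eq algebra_simps)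
  have "prd e1 f2 = comb e1 e2 (r / 2) (b * w)"
    using prd_comb[OF e, of 1 0 r w] by (simp add: comb_simps f2)
  moreover have "prd e1 f2 = smul (x * b') f2"
    by (simp add: e1 comb_def prd_bilinear ff)
  ultimately obtain k where k: "r / 2 = k * r" "b * w = k * w"
    by (auto simp: f2 smul_comb eq)
  have "r * w = 0"
  proof (cases "b = 1/2")
    case True
    then have "b + 1/2 = 1"
      using two by (simp add: field_simps)
    then show ?thesis
      using sq(2) by simp
  next
    case False
    then have "2 * b = - 1" "r = 2 * (k * r)"
      using k(1) b two by (simp_all add: field_simps)
    then have "2 * (r * w) = 0"
      using k(2) by algebra
    then show ?thesis
      using two by simp
  qed
  then have "r = 0 \<and> w = 0"
    using sq(1) two by auto
  then have "comb f1 f2 0 1 = 0"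
    by (simp add: comb_simps f2 comb_zero)
  then show False
    by (simp add: comb_eq_0_iff[OF bf])
qed

lemma commutative_table:
  assumes e: "table e1 e2 a1 a2 a2 a4 b1 b2 b2 b4"
  shows "prd u v = prd v u"
proof -
  have "basis2 e1 e2"
    using e by (simp add: table_def)
  then obtain x y z w where "u = comb e1 e2 x y" "v = comb e1 e2 z w"
    by (meson basis2_coords)
  then show ?thesis
    by (simp add: prd_comb[OF e] algebra_simps)
qed

end

section \<open>The Jordan identity in coordinates\<close>

text \<open>
  The Jordan identity is cubic in its first argument; this is how its coefficients are
  read off. The values at \<open>(1, 0)\<close>, \<open>(0, 1)\<close>, \<open>(1, 1)\<close> and \<open>(- 1, 1)\<close> suffice as \<open>2\<close> is invertible.
\<close>

lemma cubic_form_zero: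
  fixes c0 c1 c2 c3 :: "'a::field"
  assumes two: "(2::'a) \<noteq> 0"
    and zero: "\<And>x y. c3 * x^3 + c2 * x^2 * y + c1 * x * y^2 + c0 * y^3 = 0"
  shows "c3 = 0" "c2 = 0" "c1 = 0" "c0 = 0"
proof -
  show c3: "c3 = 0" and c0: "c0 = 0"
    using zero[of 1 0] zero[of 0 1] by simp_all
  have "c2 + c1 = 0" "c2 - c1 = 0"
    using zero[of 1 1] zero[of "- 1" 1] by (simp_all add: c3 c0)
  then have "2 * c1 = 0" "2 * c2 = 0"
    by algebra+
  then show "c1 = 0" "c2 = 0"
    using two by simp_all
qed

locale nontrivial_jordan_plane = jordan_algebra smul prd
  for smul :: "'f::alg_closed_field \<Rightarrow> 'v::ab_group_add \<Rightarrow> 'v" and prd +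
  fixes sqr :: "'f \<Rightarrow> 'f" and im :: 'f
  assumes two: "(2::'f) \<noteq> 0" and three: "(3::'f) \<noteq> 0" and five: "(5::'f) \<noteq> 0"
    and sqr: "(sqr a)\<^sup>2 = a" and im: "im\<^sup>2 = - 1"
    and dim: "dim (UNIV :: 'v set) = 2"
    and nontrivial: "nontrivial_algebra prd"
begin

definition listed :: bool where
  "listed \<longleftrightarrow> (\<exists>J. admissible sqr J \<and>
     algebra_isomorphic smul prd (*s) (structure_mult (jordan_matrix sqr im J)))"

lemma listedI:
  assumes "table e1 e2 a1 a2 a3 a4 b1 b2 b3 b4" "admissible sqr J"
    "jordan_matrix sqr im J = vector [vector [a1, a2, a3, a4], vector [b1, b2, b3, b4]]"
  shows listed
  unfolding listed_def using assms isomorphic_iff_table by metis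

lemma jordan_coords:
  assumes t: "table e1 e2 a1 a2 a3 a4 b1 b2 b3 b4"
  defines "m1 \<equiv> \<lambda>x y z w. a1*x*z + a2*x*w + a3*y*z + a4*y*w"
    and "m2 \<equiv> \<lambda>x y z w. b1*x*z + b2*x*w + b3*y*z + b4*y*w"
  shows "m1 (m1 x y z w) (m2 x y z w) (m1 x y x y) (m2 x y x y) =
      m1 x y (m1 z w (m1 x y x y) (m2 x y x y)) (m2 z w (m1 x y x y) (m2 x y x y))"
    and "m2 (m1 x y z w) (m2 x y z w) (m1 x y x y) (m2 x y x y) =
      m2 x y (m1 z w (m1 x y x y) (m2 x y x y)) (m2 z w (m1 x y x y) (m2 x y x y))"
proof -
  have b: "basis2 e1 e2"
    using t by (simp add: table_def)
  show "m1 (m1 x y z w) (m2 x y z w) (m1 x y x y) (m2 x y x y) =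
      m1 x y (m1 z w (m1 x y x y) (m2 x y x y)) (m2 z w (m1 x y x y) (m2 x y x y))"
    and "m2 (m1 x y z w) (m2 x y z w) (m1 x y x y) (m2 x y x y) =
      m2 x y (m1 z w (m1 x y x y) (m2 x y x y)) (m2 z w (m1 x y x y) (m2 x y x y))"
    using jordan_identity[of "comb e1 e2 x y" "comb e1 e2 z w"]
    unfolding prd_comb[OF t] comb_eq_iff[OF b] m1_def m2_def by blast+
qed

section \<open>Normal forms in the presence of an ideal line\<close>

lemma ideal_table_relations:
  assumes t: "table e1 e2 a 0 0 0 s b c 0"
  shows "(a - c - b) * (b\<^sup>2 - a * c) = 0" "s * (a * c - b\<^sup>2) = 0"
proof -
  have z: "(s * (a * c - b\<^sup>2)) * x^3 + ((a - c - b) * (b\<^sup>2 - a * c)) * x\<^sup>2 * y + 0 * x * y\<^sup>2 + 0 * y^3 = 0"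
    for x y
    using jordan_coords(2)[OF t, where x = x and y = y and z = 1 and w = 0] by simp algebra
  show "s * (a * c - b\<^sup>2) = 0" "(a - c - b) * (b\<^sup>2 - a * c) = 0"
    using cubic_form_zero(1,2)[OF two z] by simp_all
qed

lemma im_halves:
  "1/2 - im/2 \<noteq> 0" "1/2 + im/2 \<noteq> 0"
  "im * (1/2 - im/2) = 1/2 + im/2" "- im * (1/2 + im/2) = 1/2 - im/2"
proof -
  have h: "2 * (1/2) = (1::'f)" "1/2 - im/2 = 1/2 * (1 - im)" "1/2 + im/2 = 1/2 * (1 + im)"
    using two by (simp_all add: algebra_simps)
  have "(1 - im) * (1 + im) = 2"
    using im by algebra
  then show "1/2 - im/2 \<noteq> 0" "1/2 + im/2 \<noteq> 0"
    unfolding h using two by auto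
  show "im * (1/2 - im/2) = 1/2 + im/2" "- im * (1/2 + im/2) = 1/2 - im/2"
  proof -
    have "im * (1 - im) = 1 + im" "- im * (1 + im) = 1 - im"
      using im by algebra+
    then show "im * (1/2 - im/2) = 1/2 + im/2" "- im * (1/2 + im/2) = 1/2 - im/2"
      unfolding h by (metis mult.left_commute)+
  qed
qed

text \<open>
  The relation \<open>(a - c - b) (b\<^sup>2 - a c) = 0\<close> is homogeneous, so \<open>e1\<close> may be rescaled to
  normalise \<open>a + c\<close>. When \<open>a + c = 1\<close>, solutions of both factors are assigned to \<open>J4\<close> or \<open>J5\<close>; this
  is exactly what the parameters excluded from \<open>J3\<close> account for, as \<open>(2 a - 1)\<^sup>2 = a - a\<^sup>2\<close> means
  \<open>(10 a - 5)\<^sup>2 = 5\<close>. When \<open>a + c = 0\<close> the relation reads \<open>(2 a - b) (b\<^sup>2 + a\<^sup>2) = 0\<close>.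
\<close>

lemma diagonal_table_listed:
  assumes t: "table e1 e2 a 0 0 0 0 b c 0"
  shows listed
proof -
  have scale: "\<exists>f1 f2. table f1 f2 (k * a) 0 0 0 0 (k * b) (k * c) 0" if "k \<noteq> 0" for k
    using table_scale[OF t that, of 1] by auto
  have rel: "(a - c - b) * (b\<^sup>2 - a * c) = 0"
    by (rule ideal_table_relations[OF t])
  show ?thesis
  proof (cases "a + c = 0")
    case False
    define a' b' where "a' = a / (a + c)" and "b' = b / (a + c)"
    have c': "c / (a + c) = 1 - a'"
      using False by (simp add: a'_def field_simps)
    obtain f1 f2 where f: "table f1 f2 a' 0 0 0 0 b' (1 - a') 0"
      using scale[of "1 / (a + c)"] False by (auto simp: a'_def[symmetric] b'_def[symmetric] c')
    have rel': "(a' - (1 - a') - b') * (b'\<^sup>2 - a' * (1 - a')) = 0"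
      by (rule ideal_table_relations[OF f])
    show ?thesis
    proof (cases "b'\<^sup>2 = a' - a'\<^sup>2")
      case True
      then have "(b' - sqr (a' - a'\<^sup>2)) * (b' + sqr (a' - a'\<^sup>2)) = 0"
        using sqr[of "a' - a'\<^sup>2"] by algebra
      then consider "b' = sqr (a' - a'\<^sup>2)" | "b' = - sqr (a' - a'\<^sup>2)" "b' \<noteq> sqr (a' - a'\<^sup>2)"
        by (auto simp: eq_neg_iff_add_eq_0)
      then show ?thesis
      proof cases
        case 1
        show ?thesis
          by (rule listedI[OF f, of "J4 a'"]) (simp_all add: 1)
      next
        case 2
        have "b'\<^sup>2 \<noteq> 0"
          using 2 by auto
        then have "a' \<noteq> 0" "a' \<noteq> 1"
          using True by auto
        then show ?thesis
          by (intro listedI[OF f, of "J5 a'"]) (simp_all add: 2)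
      qed
    next
      case False
      then have "b'\<^sup>2 - a' * (1 - a') \<noteq> 0"
        by (simp add: algebra_simps power2_eq_square)
      then have "a' - (1 - a') - b' = 0"
        using rel' by simp
      then have b': "b' = - 1 + 2 * a'"
        by algebra
      have "a' \<noteq> 1/10 * (5 + e)" if "e\<^sup>2 = 5" for e
      proof
        assume "a' = 1/10 * (5 + e)"
        moreover have "(10::'f) \<noteq> 0"
          using two five no_zero_divisors[of 2 "5::'f"] by simp
        ultimately have "10 * a' = 5 + e"
          by (simp add: mult.commute)
        then have "20 * (b'\<^sup>2 - (a' - a'\<^sup>2)) = 0"
          using that b' by algebra
        moreover have "(20::'f) \<noteq> 0"
          using two \<open>(10::'f) \<noteq> 0\<close> no_zero_divisors[of 2 "10::'f"] by simp
        ultimately have "b'\<^sup>2 - (a' - a'\<^sup>2) = 0"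
          by (metis mult_eq_0_iff)
        then show False
          using False by simp
      qed
      from this[of "sqr 5"] this[of "- sqr 5"] show ?thesis
        by (intro listedI[OF f, of "J3 a'"]) (simp_all add: b' sqr)
    qed
  next
    case True
    then have c: "c = - a"
      by (simp add: eq_neg_iff_add_eq_0 add.commute)
    have a: "a \<noteq> 0"
    proof
      assume "a = 0"
      then have "c = 0" "b = 0"
        using c rel by (simp_all add: power2_eq_square)
      then show False
        using nontrivial_table t nontrivial \<open>a = 0\<close> by blast
    qed
    have "(2 * a - b) * ((b - im * a) * (b + im * a)) = 0"
      using rel c im by algebra
    then consider "b = 2 * a" | "b = im * a" | "b = - im * a"
      by (auto simp: eq_neg_iff_add_eq_0)
    then show ?thesis
    proof cases
      case 1
      obtain f1 f2 where f: "table f1 f2 (1/3) 0 0 0 0 (2/3) (- 1/3) 0"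
        using scale[of "1 / (3 * a)"] a three by (auto simp: 1 c)
      show ?thesis
        by (rule listedI[OF f, of J8]) simp_all
    next
      case 2
      define k where "k = (1/2 - im/2) / a"
      have k: "k \<noteq> 0" "k * a = 1/2 - im/2"
        using a im_halves by (simp_all add: k_def)
      have "k * b = im * (k * a)" "k * c = - (k * a)"
        by (simp_all only: 2 c mult_minus_right mult.left_commute)
      then obtain f1 f2 where f: "table f1 f2 (1/2 - im/2) 0 0 0 0 (1/2 + im/2) (- (1/2 - im/2)) 0"
        using scale[OF k(1)] im_halves by (auto simp: k(2))
      show ?thesis
        by (rule listedI[OF f, of J9]) simp_all
    next
      case 3
      define k where "k = (1/2 + im/2) / a"
      have k: "k \<noteq> 0" "k * a = 1/2 + im/2"
        using a im_halves by (simp_all add: k_def)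
      have "k * b = - im * (k * a)" "k * c = - (k * a)"
        by (simp_all only: 3 c mult_minus_right mult.left_commute)
      then obtain f1 f2 where f: "table f1 f2 (1/2 + im/2) 0 0 0 0 (1/2 - im/2) (- (1/2 + im/2)) 0"
        using scale[OF k(1)] im_halves by (auto simp: k(2))
      show ?thesis
        by (rule listedI[OF f, of J10]) simp_all
    qed
  qed
qed

text \<open>
  Replacing \<open>e1\<close> by \<open>e1 + k e2\<close> changes \<open>s\<close> by \<open>k (b + c - a)\<close>, so \<open>s\<close> can be made zero unless
  \<open>a = b + c\<close>. If it cannot, then \<open>b\<^sup>2 = a c\<close> as well. With \<open>a + c = 0\<close> this forces \<open>5 c\<^sup>2 = 0\<close> and
  hence \<open>J11\<close>; with \<open>a + c = 1\<close> it forces \<open>b = 2 a - 1\<close> and \<open>(10 a - 5)\<^sup>2 = 5\<close>, hence \<open>J6\<close> or \<open>J7\<close>.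
\<close>

lemma ideal_table_listed:
  assumes t: "table e1 e2 a 0 0 0 s b c 0"
  shows listed
proof (cases "a = b + c")
  case False
  define k where "k = s / (a - b - c)"
  have "a - b - c \<noteq> 0"
    using False by (simp add: algebra_simps)
  then have "k * (a - b - c) = s"
    by (simp add: k_def)
  then have "s + b * k + c * k = a * k"
    by (simp add: algebra_simps)
  then have "table (comb e1 e2 1 k) (comb e1 e2 0 1) a 0 0 0 0 b c 0"
    by (intro table_change[OF t]) simp_all
  then show ?thesis
    by (rule diagonal_table_listed)
next
  case True
  show ?thesis
  proof (cases "s = 0")
    case True
    then show ?thesis
      using t diagonal_table_listed by simp
  next
    case s: False
    then have rel: "a * c = b\<^sup>2"
      using ideal_table_relations(2)[OF t] by simp
    show ?thesis
    proof (cases "a + c = 0")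
      case ac: True
      have "5 * c\<^sup>2 = 0"
        using ac rel True by algebra
      then have c: "c = 0"
        using five by simp
      then have "a = 0" "b = 0"
        using ac True by simp_all
      then have "table (comb e1 e2 1 0) (comb e1 e2 0 s) 0 0 0 0 1 0 0 0"
        using table_scale[OF t, of 1 s] s c by simp
      then show ?thesis
        by (rule listedI[of _ _ _ _ _ _ _ _ _ _ J11]) simp_all
    next
      case ac: False
      define a' b' where "a' = a / (a + c)" and "b' = b / (a + c)"
      have c': "c / (a + c) = 1 - a'"
        unfolding a'_def using ac by (metis add_diff_cancel_left' add_divide_distrib divide_self)
      define k where "k = 1 / (a + c)"
      have "k \<noteq> 0" "k * a = a'" "k * b = b'"
        using ac by (simp_all add: k_def a'_def b'_def)
      moreover have "k * c = 1 - a'"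
        by (simp add: k_def c'[symmetric])
      ultimately have k: "k \<noteq> 0" "k * a = a'" "k * b = b'" "k * c = 1 - a'"
        by auto
      define w where "w = k\<^sup>2 * s"
      have w: "w \<noteq> 0" "k\<^sup>2 * s / w = 1"
        using k(1) s by (simp_all add: w_def)
      have f: "table (comb e1 e2 k 0) (comb e1 e2 0 w) a' 0 0 0 1 b' (1 - a') 0"
        using table_scale[OF t k(1) w(1)] by (simp add: k w)
      have b': "b' = 2 * a' - 1"
        using True k(2-4) by algebra
      have "a' * (1 - a') = b'\<^sup>2"
        using ideal_table_relations(2)[OF f] by simp
      then have "(10 * a' - 5)\<^sup>2 = (sqr 5)\<^sup>2"
        unfolding sqr b' by algebra
      then have e: "10 * a' - 5 = sqr 5 \<or> 10 * a' - 5 = - sqr 5"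
        by (simp add: power2_eq_iff)
      have ten: "(10::'f) \<noteq> 0"
        using two five no_zero_divisors[of 2 "5::'f"] by simp
      have main: "a' = 1/10 * (5 + e)" "b' = e / 5" "1 - a' = 1/10 * (5 - e)"
        if "10 * a' - 5 = e" for e
      proof -
        have a: "10 * a' = 5 + e"
          using that by (simp add: algebra_simps)
        then show "a' = 1/10 * (5 + e)"
          using ten by (simp add: field_simps)
        have "5 * b' = e"
          using a b' by algebra
        then show "b' = e / 5"
          using five by (simp add: field_simps)
        have "10 * (1 - a') = 5 - e"
          using a by algebra
        then show "1 - a' = 1/10 * (5 - e)"
          using ten by (simp add: field_simps)
      qed
      from e show ?thesis
      proof
        assume "10 * a' - 5 = sqr 5"
        note m = main[OF this]
        show ?thesis
          by (rule listedI[OF f, of J7]) (simp, simp only: jordan_matrix.simps m[symmetric])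
      next
        assume "10 * a' - 5 = - sqr 5"
        note m = main[OF this, unfolded minus_divide_left[symmetric] diff_minus_eq_add
            add_uminus_conv_diff]
        show ?thesis
          by (rule listedI[OF f, of J6]) (simp, simp only: jordan_matrix.simps m[symmetric])
      qed
    qed
  qed
qed

section \<open>Algebras with an idempotent\<close>

lemma centred_table_listed:
  assumes t: "table e1 e2 1 0 0 p 0 b 1 0" and b: "b = 1 \<or> b = - 1" and p: "p \<noteq> 0"
  shows listed
proof -
  \<comment> \<open>In terms of \<open>e1 / 2\<close> the square of \<open>e2\<close> is \<open>2 p (e1 / 2)\<close>, so \<open>e2\<close> is divided by a root of \<open>2 p\<close>.\<close>
  define w where "w = 1 / sqr (2 * p)"
  have "(sqr (2 * p))\<^sup>2 \<noteq> 0"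
    using sqr[of "2 * p"] two p by simp
  then have w: "w \<noteq> 0"
    by (simp add: w_def)
  have "w\<^sup>2 * (2 * p) = 1"
    using sqr[of "2 * p"] two p by (simp add: w_def power_divide)
  then have w1: "w\<^sup>2 / (1/2) * p = 1"
    using two by (simp add: field_simps)
  have f: "table (comb e1 e2 (1/2) 0) (comb e1 e2 0 w) (1/2) 0 0 1 0 (1/2 * b) (1/2) 0"
    using table_scale[OF t, of "1/2" w] w two w1 by simp
  from b show ?thesis
  proof
    assume "b = 1"
    then show ?thesis
      by (intro listedI[OF f, of J1]) simp_all
  next
    assume "b = - 1"
    then show ?thesis
      by (intro listedI[OF f, of J2]) simp_all
  qed
qed

text \<open>
  Here \<open>e1\<close> is a unit and the algebra is \<open>F[t] / (t\<^sup>2 - q t - p)\<close>. Completing the square makes \<open>e2 e2\<close> a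
  multiple of \<open>e1\<close>; if that multiple is zero, the new \<open>e2\<close>
  spans a nilpotent ideal.
\<close>

lemma unital_table_listed:
  assumes t: "table e1 e2 1 0 0 p 0 1 1 q"
  shows listed
proof -
  have half: "q / 2 + q / 2 = q"
    using two by (simp add: field_simps)
  have f: "table (comb e1 e2 1 0) (comb e1 e2 (- (q/2)) 1) 1 0 0 (p + q/2 * (q/2)) 0 1 1 0"
    using half by (intro table_change[OF t]) (simp_all add: algebra_simps)
  show ?thesis
  proof (cases "p + q/2 * (q/2) = 0")
    case True
    then show ?thesis
      using ideal_table_listed f by simp
  next
    case False
    then show ?thesis
      using centred_table_listed[OF f] by simp
  qed
qed

text \<open>
  If \<open>p \<noteq> 0\<close>, the Jordan identity gives \<open>c = 1\<close>, \<open>b\<^sup>2 = 1\<close> and, when \<open>b = - 1\<close>, also \<open>q = 0\<close>. If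
  \<open>p = 0\<close> and \<open>q \<noteq> 0\<close>, it gives \<open>b = c \<in> {0, 1}\<close>; for \<open>b = 0\<close> the algebra is a direct product of
  two copies of the field, with unit \<open>e1 + e2 / q\<close>.
\<close>

lemma diagonal_idempotent_table_listed:
  assumes t: "table e1 e2 1 0 0 p 0 b c q"
  shows listed
proof -
  have z1: "0 * x^3 + ((b\<^sup>2 - c) * (1 - b - c)) * x\<^sup>2 * y + (q * (c\<^sup>2 + b - 2 * b\<^sup>2)) * x * y\<^sup>2 +
      (c * p * (c - 1) + q\<^sup>2 * (c - b)) * y^3 = 0" for x y
    using jordan_coords(2)[OF t, where x = x and y = y and z = 1 and w = 0] by simp algebra
  have z2: "0 * x^3 + (p * (b\<^sup>2 + b * c - b - 2 * c + 1)) * x\<^sup>2 * y + (p * q * (b - 1)) * x * y\<^sup>2 +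
      (p\<^sup>2 * (1 - c)) * y^3 = 0" for x y
    using jordan_coords(1)[OF t, where x = x and y = y and z = 0 and w = 1] by simp algebra
  note e1 = cubic_form_zero[OF two z1] and e2 = cubic_form_zero[OF two z2]
  show ?thesis
  proof (cases "p = 0")
    case p: False
    then have c: "c = 1"
      using e2(4) by simp
    have "p * ((b - 1) * (b + 1)) = 0"
      using e2(2) c by algebra
    then have "b = 1 \<or> b = - 1"
      using p by (auto simp: eq_neg_iff_add_eq_0)
    then show ?thesis
    proof
      assume "b = 1"
      then show ?thesis
        using t c unital_table_listed by simp
    next
      assume b: "b = - 1"
      then have "2 * (p * q) = 0"
        using e2(3) by algebra
      then have "q = 0"
        using two p by simp
      then show ?thesis
        using t b c p centred_table_listed by simp
    qed
  next
    case p: True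
    show ?thesis
    proof (cases "q = 0")
      case True
      then show ?thesis
        using t p ideal_table_listed by simp
    next
      case q: False
      then have c: "c = b"
        using e1(4) p by simp
      have "b * (b - 1) = 0"
        using e1(3) q unfolding c by simp algebra
      then have "b = 0 \<or> b = 1"
        by simp
      then show ?thesis
      proof
        assume "b = 1"
        then show ?thesis
          using t c unital_table_listed by simp
      next
        assume b: "b = 0"
        have "table (comb e1 e2 1 (1/q)) (comb e1 e2 0 1) 1 0 0 0 0 1 1 q"
          using q by (intro table_change[OF t]) (simp_all add: b c p)
        then show ?thesis
          by (rule unital_table_listed)
      qed
    qed
  qed
qed

text \<open>
  For an idempotent \<open>e1\<close> the Jordan identity with \<open>u = e1\<close> says that left and right multiplication by
  \<open>e1\<close> commute. Both fix \<open>e1\<close>, so an eigenvector of one of them for an eigenvalue other than \<open>1\<close>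
  is an eigenvector of the other. If \<open>1\<close> is the only eigenvalue of both, further coefficients of the
  identity show that both are the identity map.
\<close>

lemma idempotent_table_listed:
  assumes t: "table e1 e2 1 l r p 0 b c q"
  shows listed
proof -
  have comm: "l + r * b = r + l * c"
    using jordan_coords(1)[OF t, where x = 1 and y = 0 and z = 0 and w = 1] by simp
  \<comment> \<open>These are the conditions for \<open>e2 + k e1\<close> to be a common eigenvector.\<close>
  have "\<exists>k. k * (b - 1) = l \<and> k * (c - 1) = r"
  proof (cases "b = 1")
    case b: True
    show ?thesis
    proof (cases "c = 1")
      case False
      then have "l = 0"
        using comm b by simp
      moreover have "r / (c - 1) * (c - 1) = r"
        using False by simp
      ultimately show ?thesis
        using b by (intro exI[of _ "r / (c - 1)"]) simp
    next
      case c: True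
      have z1: "0 * x^3 + (r - 2 * l) * x\<^sup>2 * y + (l * r + r\<^sup>2 - l * q) * x * y\<^sup>2 + (p * r) * y^3 = 0"
        for x y
        using jordan_coords(1)[OF t, where x = x and y = y and z = 1 and w = 0]
        unfolding b c by simp algebra
      have z2: "0 * x^3 + 0 * x\<^sup>2 * y + (2 * (r - l)) * x * y\<^sup>2 + (q * (r - l)) * y^3 = 0"
        for x y
        using jordan_coords(2)[OF t, where x = x and y = y and z = 1 and w = 0]
        unfolding b c by simp algebra
      have "r = 2 * l" "r = l"
        using cubic_form_zero(2)[OF two z1] cubic_form_zero(3)[OF two z2] two by simp_all
      then have "l + l = l" "r = l"
        by (simp_all only: mult_2)
      then have "l = 0" "r = 0"
        by (metis add_cancel_right_right)+
      then show ?thesis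
        by (intro exI[of _ 0]) simp
    qed
  next
    case False
    define k where "k = l / (b - 1)"
    have k: "k * (b - 1) = l"
      using False by (simp add: k_def)
    have "l * (c - 1) - r * (b - 1) = 0"
      using comm by (simp add: algebra_simps)
    then have "(b - 1) * (k * (c - 1) - r) = 0"
      unfolding k[symmetric] by algebra
    then show ?thesis
      using k False by auto
  qed
  then obtain k where k: "k * (b - 1) = l" "k * (c - 1) = r"
    by blast
  define q' p' where "q' = q + (b + c) * k" and "p' = p + (k + l + r) * k - q' * k"
  have "table (comb e1 e2 1 0) (comb e1 e2 k 1) 1 0 0 p' 0 b c q'"
    by (intro table_change[OF t]) (simp_all add: p'_def q'_def k[symmetric] algebra_simps)
  then show ?thesis
    by (rule diagonal_idempotent_table_listed)
qed

section \<open>Algebras with a vector of square zero\<close>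

text \<open>
  If \<open>b \<noteq> 0\<close>, the multiplication turns out to be antisymmetric, and \<open>e1 e2\<close> spans an
  ideal. If \<open>b = c = 0\<close>, the line of \<open>e1\<close> itself is an ideal. If \<open>b = 0 \<noteq> c\<close>, then \<open>e2\<close> can be sheared
  to have square zero as well, with \<open>e1 e2 = l e1\<close> and \<open>e2 e1 = c e2\<close>: for \<open>l = 0\<close> the line of \<open>e2\<close>
  is an ideal, and otherwise \<open>e1 / c + e2 / l\<close> is idempotent.
\<close>

lemma square_zero_table_listed:
  assumes t: "table e1 e2 0 l r p 0 b c q"
  shows listed
proof -
  have z1: "0 * x^3 + (- b * l * (b + c)) * x\<^sup>2 * y +
      (p * (c\<^sup>2 - b\<^sup>2) + c * r * (l + r) - b * l * q) * x * y\<^sup>2 + (p * (c * q + c * r - b * q)) * y^3 = 0"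
    for x y
    using jordan_coords(1)[OF t, where x = x and y = y and z = 1 and w = 0] by simp algebra
  have z2: "0 * x^3 + (- (b\<^sup>2) * (b + c)) * x\<^sup>2 * y +
      (b\<^sup>2 * (r - 2 * q) + b * c * (r - l) + c\<^sup>2 * (q + r)) * x * y\<^sup>2 +
      (b * q * (r - q) + c\<^sup>2 * p + c * q * (q - l)) * y^3 = 0" for x y
    using jordan_coords(2)[OF t, where x = x and y = y and z = 1 and w = 0] by simp algebra
  note e1 = cubic_form_zero[OF two z1] and e2 = cubic_form_zero[OF two z2]
  show ?thesis
  proof (cases "b = 0")
    case b: False
    have c: "c = - b"
      using e2(2) b by (simp add: add_eq_0_iff)
    have "b\<^sup>2 * (l + r - q) = 0"
      using e2(3) c by algebra
    then have q: "q = l + r"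
      using b by simp
    have "b * (l + r)\<^sup>2 = 0"
      using e1(3) c q by algebra
    then have r: "r = - l"
      using b by (simp add: add_eq_0_iff)
    then have q: "q = 0"
      using q by simp
    have p: "p = 0"
      using e2(4) b by (simp add: q c)
    have "table (comb e1 e2 1 0) (comb e1 e2 l b) 0 0 0 0 0 b (- b) 0"
      using b by (intro table_change[OF t]) (simp_all add: p q r c)
    then show ?thesis
      by (rule ideal_table_listed)
  next
    case b: True
    show ?thesis
    proof (cases "c = 0")
      case c: True
      have "table (comb e1 e2 0 1) (comb e1 e2 1 0) q 0 0 0 p r l 0"
        by (intro table_change[OF t]) (simp_all add: b c)
      then show ?thesis
        by (rule ideal_table_listed)
    next
      case c: False
      have "c\<^sup>2 * (q + r) = 0"
        using e2(3) b by simp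
      then have q: "q = - r"
        using c by (simp add: eq_neg_iff_add_eq_0)
      define m where "m = r / c"
      have r: "r = m * c"
        using c by (simp add: m_def)
      have "c\<^sup>2 * (p + m * (l + r)) = 0"
        using e1(3) b r by algebra
      then have p: "p = - (m * (l + r))"
        using c by (simp add: eq_neg_iff_add_eq_0)
      define f1 f2 where "f1 = comb e1 e2 1 0" and "f2 = comb e1 e2 m 1"
      have f: "table f1 f2 0 l 0 0 0 0 c 0"
        unfolding f1_def f2_def
        by (intro table_change[OF t]) (simp_all add: b p q r algebra_simps)
      show ?thesis
      proof (cases "l = 0")
        case True
        then show ?thesis
          using f ideal_table_listed by simp
      next
        case l: False
        let ?u = "comb f1 f2 (1/c) (1/l)"
        have "prd ?u ?u = smul 1 ?u"
          using l c by (simp add: prd_comb[OF f])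
        moreover have "basis2 ?u (comb f1 f2 0 1)"
          using f c by (intro basis2_change) (simp_all add: table_def)
        ultimately show ?thesis
          using eigen_square_table idempotent_table_listed by metis
      qed
    qed
  qed
qed

section \<open>Every nontrivial Jordan plane is listed\<close>

text \<open>
  For \<open>u = e1 + x e2\<close> the condition that \<open>u u\<close> is a multiple of \<open>u\<close> is a polynomial equation in \<open>x\<close> with
  leading term \<open>a4 x\<^sup>3\<close>; if \<open>a4 = 0\<close>, then \<open>u = e2\<close> is a solution.
\<close>

lemma ex_eigen_square:
  obtains u v k where "basis2 u v" "prd u u = smul k u"
proof -
  obtain e1 e2 where b: "basis2 e1 e2"
    using dim2_basis2[OF dim] .
  obtain a1 a2 a3 a4 b1 b2 b3 b4 where t: "table e1 e2 a1 a2 a3 a4 b1 b2 b3 b4"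
    by (rule basis_table[OF b])
  show thesis
  proof (cases "a4 = 0")
    case True
    have "basis2 e2 e1"
      using basis2_change[OF b, of 0 0 1 1] by (simp add: comb_simps)
    moreover have "prd e2 e2 = smul b4 e2"
      using t True by (simp add: table_iff comb_def)
    ultimately show thesis
      by (rule that)
  next
    case False
    define P where "P = [:- b1, a1 - b2 - b3, a2 + a3 - b4, a4:]"
    have "degree P > 0"
      using False by (simp add: P_def)
    then obtain x where "poly P x = 0"
      using alg_closed_imp_poly_has_root by blast
    then have "b1 + b2 * x + b3 * x + b4 * x * x = (a1 + a2 * x + a3 * x + a4 * x * x) * x"
      by (simp add: P_def algebra_simps)
    then have "prd (comb e1 e2 1 x) (comb e1 e2 1 x) =
        smul (a1 + a2 * x + a3 * x + a4 * x * x) (comb e1 e2 1 x)"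
      by (simp add: prd_comb[OF t] smul_comb)
    moreover have "basis2 (comb e1 e2 1 x) (comb e1 e2 0 1)"
      by (rule basis2_change[OF b]) simp
    ultimately show thesis
      using that by blast
  qed
qed

theorem jordan_plane_listed: listed
proof -
  obtain u v k where b: "basis2 u v" and k: "prd u u = smul k u"
    by (rule ex_eigen_square)
  obtain l r p b' c q where t: "table u v k l r p 0 b' c q"
    by (rule eigen_square_table[OF b k])
  show ?thesis
  proof (cases "k = 0")
    case True
    then show ?thesis
      using t square_zero_table_listed by simp
  next
    case False
    then show ?thesis
      using table_scale[OF t, of "1 / k" 1] idempotent_table_listed by simp
  qed
qed

section \<open>The members of the list are not isomorphic to each other\<close>

text \<open>
  The label \<open>J\<close> has a table with an ideal line, with entries \<open>a\<close>, \<open>b\<close>, \<open>c\<close> and \<open>s\<close>. The four groups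
  are told apart by \<open>a + c\<close>, \<open>a\<close> and \<open>s\<close>. Admissibility is recorded as the inequality that separates
  \<open>J3\<close> from \<open>J4\<close> and \<open>J5\<close>, or \<open>J5\<close> from \<open>J4\<close>. The value of \<open>s\<close> is left open for \<open>J11\<close>, which is
  determined by \<open>a = b = c = 0\<close>.
\<close>

definition ideal_label :: "'f jordan_label \<Rightarrow> 'f \<Rightarrow> 'f \<Rightarrow> 'f \<Rightarrow> 'f \<Rightarrow> bool" where
  "ideal_label J a b c s \<longleftrightarrow>
     a + c = 1 \<and> s = 0 \<and>
       (J = J3 a \<and> b = 2 * a - 1 \<and> b\<^sup>2 \<noteq> a - a\<^sup>2 \<or> J = J4 a \<and> b = sqr (a - a\<^sup>2) \<or>
        J = J5 a \<and> b = - sqr (a - a\<^sup>2) \<and> b \<noteq> sqr (a - a\<^sup>2)) \<or>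
     a + c = 1 \<and> s = 1 \<and> a = b + c \<and>
       (J = J6 \<and> 10 * a = 5 + - sqr 5 \<or> J = J7 \<and> 10 * a = 5 + sqr 5) \<or>
     a + c = 0 \<and> a \<noteq> 0 \<and> s = 0 \<and>
       (J = J8 \<and> b = 2 * a \<or> J = J9 \<and> b = im * a \<or> J = J10 \<and> b = - im * a) \<or>
     a = 0 \<and> b = 0 \<and> c = 0 \<and> J = J11"

text \<open>
  The hypotheses on the entries are those supplied by \<open>square_zero_ideal_unique\<close>. In the group
  \<open>a + c = 1\<close> the factor \<open>p\<close> must be \<open>1\<close>; there \<open>J6\<close> and \<open>J7\<close>, which satisfy \<open>a = b + c\<close>, are separated
  from the other labels by \<open>s\<close> and from each other by the sign of \<open>sqr 5\<close>. In the group \<open>a + c = 0\<close>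
  the ratio \<open>b / a\<close> is one of \<open>2\<close>, \<open>im\<close> and \<open>- im\<close>, which are distinct because \<open>2\<close> and \<open>5\<close> are nonzero.
\<close>

lemma ideal_label_unique:
  assumes "ideal_label J a b c s" "ideal_label J' (p * a) (p * b) (p * c) s'" "p \<noteq> 0"
    and s: "a = b + c \<longrightarrow> (s = 0 \<longleftrightarrow> s' = 0)"
  shows "J = J'"
proof -
  have tr: "p * a + p * c = p * (a + c)"
    by (simp add: distrib_left)
  consider "a + c = 1" | "a + c = 0" "a \<noteq> 0" | "a = 0" "c = 0" "J = J11"
    using assms(1) unfolding ideal_label_def by blast
  then show ?thesis
  proof cases
    case 1
    then have ac: "p * a + p * c = p" "a + c \<noteq> 0" "\<not> (a = 0 \<and> c = 0)"
      unfolding tr by auto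
    then have "p * a + p * c \<noteq> 0" "\<not> (p * a = 0 \<and> p * c = 0)"
      using \<open>p \<noteq> 0\<close> by auto
    then have "p * a + p * c = 1"
      using assms(2) unfolding ideal_label_def by blast
    then have p: "p = 1"
      by (simp only: ac)
    have J: "s = 0 \<and> (J = J3 a \<and> b = 2 * a - 1 \<and> b\<^sup>2 \<noteq> a - a\<^sup>2 \<or> J = J4 a \<and> b = sqr (a - a\<^sup>2) \<or>
        J = J5 a \<and> b = - sqr (a - a\<^sup>2) \<and> b \<noteq> sqr (a - a\<^sup>2)) \<or>
      s = 1 \<and> a = b + c \<and> (J = J6 \<and> 10 * a = 5 + - sqr 5 \<or> J = J7 \<and> 10 * a = 5 + sqr 5)"
      using assms(1) ac(2,3) unfolding ideal_label_def by blast
    have J': "s' = 0 \<and> (J' = J3 a \<and> b = 2 * a - 1 \<and> b\<^sup>2 \<noteq> a - a\<^sup>2 \<or> J' = J4 a \<and> b = sqr (a - a\<^sup>2) \<or>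
        J' = J5 a \<and> b = - sqr (a - a\<^sup>2) \<and> b \<noteq> sqr (a - a\<^sup>2)) \<or>
      s' = 1 \<and> a = b + c \<and> (J' = J6 \<and> 10 * a = 5 + - sqr 5 \<or> J' = J7 \<and> 10 * a = 5 + sqr 5)"
      using assms(2) ac(2,3) unfolding ideal_label_def p mult_1 by blast
    have sq: "b\<^sup>2 = a - a\<^sup>2" if "b = sqr (a - a\<^sup>2) \<or> b = - sqr (a - a\<^sup>2)"
      using that sqr[of "a - a\<^sup>2"] by (metis power2_minus)
    have root: "5 + - sqr 5 \<noteq> 5 + sqr 5"
    proof
      assume "5 + - sqr 5 = 5 + sqr 5"
      then have "2 * sqr 5 = 0"
        by (metis add_left_cancel add.right_inverse mult_2)
      then show False
        using two five sqr[of 5] by simp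
    qed
    show ?thesis
    proof (cases "s = 0")
      case True
      then have "s \<noteq> 1" "s' \<noteq> 1"
        using J' s by auto
      then show ?thesis
        using J J' sq by blast
    next
      case False
      then have "s' \<noteq> 0"
        using J s by auto
      then show ?thesis
        using J J' root False by metis
    qed
  next
    case 2
    then have c: "c = - a"
      by (simp add: eq_neg_iff_add_eq_0 add.commute)
    have J: "J = J8 \<and> b = 2 * a \<or> J = J9 \<and> b = im * a \<or> J = J10 \<and> b = - im * a"
      using assms(1) 2 zero_neq_one unfolding ideal_label_def by metis
    have cancel: "b = k * a" if "p * b = k * (p * a)" for k
      using that \<open>p \<noteq> 0\<close> by (metis mult.left_commute mult_left_cancel)
    have "p * a + p * c \<noteq> 1" "p * a \<noteq> 0"
      using 2 \<open>p \<noteq> 0\<close> by (simp_all add: tr)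
    then have "J' = J8 \<and> p * b = 2 * (p * a) \<or> J' = J9 \<and> p * b = im * (p * a) \<or>
        J' = J10 \<and> p * b = - im * (p * a)"
      using assms(2) unfolding ideal_label_def by blast
    then have J': "J' = J8 \<and> b = 2 * a \<or> J' = J9 \<and> b = im * a \<or> J' = J10 \<and> b = - im * a"
      using cancel by blast
    have "im \<noteq> 0" "im \<noteq> - im" "2 \<noteq> im" "2 \<noteq> - im"
    proof -
      show "im \<noteq> 0"
        using im by auto
      moreover have "2 * im = 0" if "im = - im"
        using that by (metis add.right_inverse mult_2)
      ultimately show "im \<noteq> - im"
        using two by auto
      have "2\<^sup>2 \<noteq> im\<^sup>2"
      proof
        assume "2\<^sup>2 = im\<^sup>2"
        then have "(5::'f) = 0"
          unfolding im by simp
        then show False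
          using five by simp
      qed
      then show "2 \<noteq> im" "2 \<noteq> - im"
        by (metis, metis power2_minus)
    qed
    then have "im * a \<noteq> - im * a" "2 * a \<noteq> im * a" "2 * a \<noteq> - im * a"
      using \<open>a \<noteq> 0\<close> by (simp_all only: mult_cancel_right simp_thms)
    then show ?thesis
      using J J' by metis
  next
    case 3
    then show ?thesis
      using assms(2) unfolding ideal_label_def by auto
  qed
qed

lemma admissible_label_cases:
  assumes adm: "admissible sqr J"
  obtains b where "b = 1/2 \<or> b = - (1/2)" "J = (if b = 1/2 then J1 else J2)"
      "jordan_matrix sqr im J = vector [vector [1/2, 0, 0, 1], vector [0, b, 1/2, 0]]"
  | a b c s where "jordan_matrix sqr im J = vector [vector [a, 0, 0, 0], vector [s, b, c, 0]]"
      "ideal_label J a b c s"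
proof -
  have ten: "(10::'f) \<noteq> 0"
    using two five no_zero_divisors[of 2 "5::'f"] by simp
  have "10 * (1/10) = (1::'f)"
    using ten by simp
  then have tenth: "10 * (1/10 * x) = x" for x :: 'f
    by (metis mult.assoc mult_1)
  have golden: "a + c = 1" "a = b + c" if "10 * a = 5 + e" "5 * b = e" "10 * c = 5 - e" for a b c e :: 'f
  proof -
    have "10 * (a + c - 1) = 0" "10 * (a - (b + c)) = 0"
      using that by algebra+
    then have "a + c - 1 = 0" "a - (b + c) = 0"
      using ten by (metis mult_eq_0_iff)+
    then show "a + c = 1" "a = b + c"
      by simp_all
  qed
  have half: "1/2 \<noteq> - (1/2::'f)"
    using two by (simp add: field_simps)
  have nj: "2 * a - 1 \<noteq> e" 
    if "a \<noteq> 1/10 * (5 + sqr 5)" "a \<noteq> 1/10 * (5 - sqr 5)" "e\<^sup>2 = a - a\<^sup>2" for a e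
  proof
    assume "2 * a - 1 = e"
    then have "(2 * a - 1)\<^sup>2 = a - a\<^sup>2"
      using that(3) by simp
    moreover have "(10 * a - 5)\<^sup>2 - 5 = 20 * ((2 * a - 1)\<^sup>2 - (a - a\<^sup>2))"
      by algebra
    ultimately have "(10 * a - 5)\<^sup>2 = (sqr 5)\<^sup>2"
      unfolding sqr by simp
    then have "10 * a - 5 = sqr 5 \<or> 10 * a - 5 = - sqr 5"
      by (simp add: power2_eq_iff)
    then have "10 * a = 5 + sqr 5 \<or> 10 * a = 5 - sqr 5"
      by (simp add: algebra_simps)
    then show False
      using that(1,2) ten by (auto simp: field_simps)
  qed
  show thesis
  proof (cases J)
    case J1
    then show thesis by (intro that(1)[of "1/2"]) simp_all
  next
    case J2
    then show thesis using half by (intro that(1)[of "- (1/2)"]) auto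
  next
    case (J3 a)
    then show thesis
      using adm nj[of a "2 * a - 1"]
      by (intro that(2)[of a 0 "2 * a - 1" "1 - a"]) (auto simp: ideal_label_def)
  next
    case (J4 a)
    then show thesis by (intro that(2)[of a 0 "sqr (a - a\<^sup>2)" "1 - a"])
      (simp_all add: ideal_label_def)
  next
    case (J5 a)
    have "- sqr (a - a\<^sup>2) \<noteq> sqr (a - a\<^sup>2)"
    proof
      assume "- sqr (a - a\<^sup>2) = sqr (a - a\<^sup>2)"
      then have "2 * sqr (a - a\<^sup>2) = 0"
        by (metis add.right_inverse mult_2)
      then have "sqr (a - a\<^sup>2) = 0"
        using two by simp
      then have "a * (1 - a) = 0"
        using sqr[of "a - a\<^sup>2"] by (simp add: algebra_simps power2_eq_square)
      then show False
        using adm J5 by simp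
    qed
    then show thesis
      using J5 by (intro that(2)[of a 0 "- sqr (a - a\<^sup>2)" "1 - a"])
        (simp_all add: ideal_label_def)
  next
    case J6
    have "10 * (1/10 * (5 - sqr 5)) = 5 + - sqr 5" "5 * (- (sqr 5 / 5)) = - sqr 5"
      "10 * (1/10 * (5 + sqr 5)) = 5 - - sqr 5"
      unfolding tenth using five by simp_all
    note e = this(1) golden[OF this]
    then show thesis
      by (intro that(2)[of "1/10 * (5 - sqr 5)" 1 "- (sqr 5 / 5)" "1/10 * (5 + sqr 5)"])
        (simp_all only: J6 jordan_matrix.simps ideal_label_def simp_thms)
  next
    case J7
    have "10 * (1/10 * (5 + sqr 5)) = 5 + sqr 5" "5 * (sqr 5 / 5) = sqr 5"
      "10 * (1/10 * (5 - sqr 5)) = 5 - sqr 5"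
      unfolding tenth using five by simp_all
    note e = this(1) golden[OF this]
    then show thesis
      by (intro that(2)[of "1/10 * (5 + sqr 5)" 1 "sqr 5 / 5" "1/10 * (5 - sqr 5)"])
        (simp_all only: J7 jordan_matrix.simps ideal_label_def simp_thms)
  next
    case J8
    then show thesis using three by (intro that(2)[of "1/3" 0 "2/3" "- 1/3"]) (simp_all add: ideal_label_def)
  next
    case J9
    then show thesis
      using im_halves by (intro that(2)[of "1/2 - im/2" 0 "1/2 + im/2" "- 1/2 + im/2"]) (simp_all add: ideal_label_def)
  next
    case J10
    then show thesis
      using im_halves by (intro that(2)[of "1/2 + im/2" 0 "1/2 - im/2" "- 1/2 - im/2"]) (simp_all add: ideal_label_def)
  next
    case J11
    then show thesis by (intro that(2)[of 0 1 0 0]) (simp_all add: ideal_label_def)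
  qed
qed

theorem label_unique:
  assumes "admissible sqr J" "admissible sqr J'"
    and iso: "algebra_isomorphic smul prd (*s) (structure_mult (jordan_matrix sqr im J))"
    and iso': "algebra_isomorphic smul prd (*s) (structure_mult (jordan_matrix sqr im J'))"
  shows "J = J'"
  using assms(1)
proof (cases rule: admissible_label_cases)
  case (1 b)
  from iso obtain e1 e2 where e: "table e1 e2 (1/2) 0 0 1 0 b (1/2) 0"
    unfolding 1(3) isomorphic_iff_table by blast
  from assms(2) show ?thesis
  proof (cases rule: admissible_label_cases)
    case j: (1 b')
    from iso' obtain f1 f2 where f: "table f1 f2 (1/2) 0 0 1 0 b' (1/2) 0"
      unfolding j(3) isomorphic_iff_table by blast
    have commute: "d = 1/2" if "table g1 g2 (1/2) 0 0 1 0 d (1/2) 0" "\<And>u v. prd u v = prd v u"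
      for g1 g2 d
      using that(1) that(2)[of g1 g2] by (auto simp: table_iff comb_eq_iff)
    have "b = 1/2 \<longleftrightarrow> b' = 1/2"
      using commute e f commutative_table by metis
    then show ?thesis
      using 1 j by simp
  next
    case (2 a b' c s)
    from iso' obtain f1 f2 where f: "table f1 f2 a 0 0 0 s b' c 0"
      unfolding 2(1) isomorphic_iff_table by blast
    show ?thesis
      using no_square_zero_ideal[OF two e 1(1) f] ..
  qed
next
  case (2 a b c s)
  from iso obtain e1 e2 where e: "table e1 e2 a 0 0 0 s b c 0"
    unfolding 2(1) isomorphic_iff_table by blast
  from assms(2) show ?thesis
  proof (cases rule: admissible_label_cases)
    case j: (1 b')
    from iso' obtain f1 f2 where f: "table f1 f2 (1/2) 0 0 1 0 b' (1/2) 0"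
      unfolding j(3) isomorphic_iff_table by blast
    show ?thesis
      using no_square_zero_ideal[OF two f j(1) e] ..
  next
    case j: (2 a' b' c' s')
    from iso' obtain f1 f2 where f: "table f1 f2 a' 0 0 0 s' b' c' 0"
      unfolding j(1) isomorphic_iff_table by blast
    obtain p where "p \<noteq> 0" "a' = p * a" "b' = p * b" "c' = p * c"
      "a = b + c \<longrightarrow> (s = 0 \<longleftrightarrow> s' = 0)"
      using square_zero_ideal_unique[OF e f nontrivial] by blast
    then show ?thesis
      using ideal_label_unique[OF 2(2)] j(2) by simp
  qed
qed

end

lemma of_nat_prime_neq_0:
  assumes "prime p" "CHAR('a::field) \<noteq> p"
  shows "of_nat p \<noteq> (0::'a)"
proof
  assume "of_nat p = (0::'a)"
  then have "CHAR('a) dvd p"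
    by (simp add: of_nat_eq_0_iff_char_dvd)
  then show False
    using assms CHAR_not_1 by (auto simp: prime_nat_iff)
qed

theorem theorem3p1:
  fixes smul :: "'f::alg_closed_field \<Rightarrow> 'v::ab_group_add \<Rightarrow> 'v"
    and prd :: "'v \<Rightarrow> 'v \<Rightarrow> 'v"
    and sqr :: "'f \<Rightarrow> 'f"
    and im :: 'f
  assumes char: "CHAR('f) \<noteq> 2" "CHAR('f) \<noteq> 3" "CHAR('f) \<noteq> 5"
    and sqr: "\<And>a. (sqr a)^2 = a"
    and im: "im^2 = - 1"
    and jordan: "jordan_algebra smul prd"
    and dim: "vector_space.dim smul (UNIV :: 'v set) = 2"
    and nontrivial: "nontrivial_algebra prd"
  shows "\<exists>!J. admissible sqr J \<and>
           algebra_isomorphic smul prd (*s) (structure_mult (jordan_matrix sqr im J))"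
proof -
  have "prime (2::nat)" "prime (3::nat)" "prime (5::nat)"
    by (simp_all add: prime_nat_numeral_eq)
  then have "(2::'f) \<noteq> 0" "(3::'f) \<noteq> 0" "(5::'f) \<noteq> 0"
    using of_nat_prime_neq_0[of _, where 'a = 'f] char by (metis of_nat_numeral)+
  then interpret nontrivial_jordan_plane smul prd sqr im
    using sqr im dim nontrivial jordan
    by (simp add: nontrivial_jordan_plane_def nontrivial_jordan_plane_axioms_def)
  show ?thesis
    using jordan_plane_listed label_unique unfolding listed_def by blast
qed

end
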